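(* Let $q$ be a positive integer and let $\{K_n\}_{n\in\mathbb{N}}$ be a family of real quadratic fields with integral ideals $\mathfrak{b}_n\subset K_n$ relatively prime to $q$ and $\mathfrak{b}_n^{-1}=[1,\delta(n)]:=\mathbb{Z}+\delta(n)\mathbb{Z}$. Suppose $\delta(n)-1=[[a_0(n),a_1(n),\dots,a_{s-1}(n)]]$ with $s$ independent of $n$, $a_i(n)=\alpha_i n+\beta_i$ for fixed $\alpha_i,\beta_i\in\mathbb{Z}$, and write $a_i(r)=q\tau_i(r)+\gamma_i(r)$ with $\gamma_i(r)=\langle a_i(r)\rangle_q$, where $a_i(r):=\alpha_i r+\beta_i$. Let $C,D$ be integers and let $d^{l}_{CD}(r):=\langle\nu^{\Gamma_l(r)+1}_{CD}(r)-\nu^{\Gamma_l(r)}_{CD}(r)\rangle$. Then for $n=qk+r$ with $0\le r\le q-1$ we have $$\sum_{i=1}^{m(n)}\Bigl(B_1(x^i_{C+D\delta(n)})B_1(y^i_{C+D\delta(n)})+\frac{b_i(n)}{2}B_2(x^i_{C+D\delta(n)})\Bigr)=\frac{1}{12}\bigl(A_{CD}(r)+kB_{CD}(r)\bigr),$$ where $$\begin{aligned}A_{CD}(r):={}&\sum_{l=1}^{s\mu(s)}\Bigl(-12B_1(\nu^{\Gamma_l(r)}_{CD}(r))B_1(\nu^{\Gamma_l(r)-1}_{CD}(r))+6(a_{2l}(r)+2)B_2(\nu^{\Gamma_l(r)}_{CD}(r))\Bigr)\\&+\sum_{l=0}^{s\mu(s)-1}\Bigl[6\Bigl((\gamma_{2l+1}(r)-1)d^l_{CD}(r)^2+(1-2d^l_{CD}(r))\bigl[\nu^{\Gamma_l(r)}_{CD}(r)+d^l_{CD}(r)(\gamma_{2l+1}(r)-1)\bigr]_1\\&\qquad+B_2(\nu^{\Gamma_{l+1}(r)-1}_{CD}(r))-B_2(\nu^{\Gamma_l(r)}_{CD}(r))\Bigr)-\gamma_{2l+1}(r)+1\\&\qquad+\tau_{2l+1}(r)\Bigl(6\bigl(q\,d^l_{CD}(r)^2+(1-2d^l_{CD}(r))[\nu^{\Gamma_l(r)}_{CD}(r)+d^l_{CD}(r)q]_1\bigr)-q\Bigr)\Bigr]\end{aligned}$$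 and $$\begin{aligned}B_{CD}(r):={}&\sum_{l=1}^{s\mu(s)}6q\,\alpha_{2l}B_2(\nu^{\Gamma_l(r)}_{CD}(r))\\&+\sum_{l=0}^{s\mu(s)-1}\alpha_{2l+1}\Bigl(6\bigl(q\,d^l_{CD}(r)^2+(1-2d^l_{CD}(r))[\nu^{\Gamma_l(r)}_{CD}(r)+d^l_{CD}(r)q]_1\bigr)-q\Bigr).\end{aligned}$$
   Context: A real embedding of each $K_n$ is fixed. For real $x$: $\langle x\rangle:=x-\lfloor x\rfloor$ if $x\notin\mathbb{Z}$ and $\langle x\rangle:=1$ if $x\in\mathbb{Z}$; $[x]_1:=x-\langle x\rangle$. For an integer $t$, $\langle t\rangle_q$ is the unique integer in $[1,q]$ congruent to $t$ mod $q$. $B_1(x)=x-\frac12$, $B_2(x)=x^2-x+\frac16$. $\mu(s)=1$ if $s$ is odd, $\mu(s)=\frac12$ if $s$ is even. $[[a_0,\dots,a_{s-1}]]$ is the purely periodic usual (plus) continued fraction with positive integer partial quotients $a_0,\dots,a_{s-1}$ repeated. The indices of $a_i(n),\alpha_i,\beta_i,\tau_i,\gamma_i$ are extended to all $i\ge0$ with period $s$. (One has $\delta(n)>2$, $0<\delta(n)'<1$, with $'$ the conjugation.) Define $S_0(n)=0$, $S_j(n)=S_{j-1}(n)+a_{2j-1}(n)$ for $j\ge1$; $m(n):=S_{s\mu(s)}(n)$; and $b_i(n):=a_{2j}(n)+2$ if $i=S_j(n)$ for some $j\ge0$, $b_i(n):=2$ for other $i\ge0$; this is periodic with period $m(n)$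 and is extended to $i\in\mathbb{Z}$ by periodicity. Then $\delta(n)=((b_0(n),\dots,b_{m(n)-1}(n)))$, where $((b_0,\dots,b_{m-1}))$ denotes the purely periodic minus continued fraction $b_0-\cfrac{1}{b_1-\cfrac{1}{b_2-\cdots}}$ with $b_{i+m}=b_i$. Put $\delta_k(n)=((b_k(n),\dots,b_{k+m(n)-1}(n)))$ and define $\{A_k(n)\}_{k\in\mathbb{Z}}$ by $A_{-1}(n)=\delta(n)$, $A_0(n)=1$, $A_{k+1}(n)=A_k(n)/\delta_{k+1}(n)$. Any two consecutive $A_{i-1}(n),A_i(n)$ form a $\mathbb{Z}$-basis of $\mathfrak{b}_n^{-1}$. For integers $C,D,i$, $(x^i_{C+D\delta(n)},y^i_{C+D\delta(n)})$ is the unique pair in $(0,1]\times[0,1)$ with $$x^i_{C+D\delta(n)}A_{i-1}(n)+y^i_{C+D\delta(n)}A_i(n)\in\frac{C+D\delta(n)}{q}+\mathfrak{b}_n^{-1}.$$ For $0\le r\le q-1$: $\Gamma_0(r)=0$, $\Gamma_j(r)=\Gamma_{j-1}(r)+\gamma_{2j-1}(r)$ for $j\ge1$; for $i\ge0$, $c_i(r)=\gamma_{2j}(r)+2$ if $i=\Gamma_j(r)$ for some $j\ge0$ and $c_i(r)=2$ otherwise. The sequence $\{\nu^i_{CD}(r)\}_{i\ge-1}$ is defined by $\nu^{-1}_{CD}(r)=\frac{q-C}{q}$, $\nu^0_{CD}(r)=\langle\frac Dq\rangle$, $\nu^{i+1}_{CD}(r)=\langle c_i(r)\nu^i_{CD}(r)-\nu^{i-1}_{CD}(r)\rangle$.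 *)

theory Defs
  imports
    Complex_Main
    "HOL-Number_Theory.Cong"
    "HOL-Computational_Algebra.Polynomial"
begin

text \<open>
  A real quadratic field together with a fixed real embedding is a subfield of the reals
  whose dimension over the rationals is 2.
\<close>

lemma vector_space_rat_real: "vector_space (\<lambda>(c::rat) (x::real). of_rat c * x)"
  by unfold_locales (simp_all add: algebra_simps of_rat_add of_rat_mult)

definition real_quadratic_field :: "real set \<Rightarrow> bool" where
  "real_quadratic_field K \<longleftrightarrow>
     1 \<in> K \<and> (\<forall>x\<in>K. \<forall>y\<in>K. x - y \<in> K \<and> x * y \<in> K) \<and> (\<forall>x\<in>K. x \<noteq> 0 \<longrightarrow> inverse x \<in> K) \<and>
     vector_space.dim (\<lambda>(c::rat) (x::real). of_rat c * x) K = 2"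

definition ring_of_integers :: "real set \<Rightarrow> real set" where
  "ring_of_integers K = {x \<in> K. algebraic_int x}"

definition integral_ideal :: "real set \<Rightarrow> real set \<Rightarrow> bool" where
  "integral_ideal K \<bb> \<longleftrightarrow>
     \<bb> \<subseteq> ring_of_integers K \<and> 0 \<in> \<bb> \<and> \<bb> \<noteq> {0} \<and>
     (\<forall>x\<in>\<bb>. \<forall>y\<in>\<bb>. x + y \<in> \<bb>) \<and>
     (\<forall>z\<in>ring_of_integers K. \<forall>x\<in>\<bb>. z * x \<in> \<bb>)"

definition ideal_inverse :: "real set \<Rightarrow> real set \<Rightarrow> real set" where
  "ideal_inverse K \<bb> = {x \<in> K. \<forall>y\<in>\<bb>. x * y \<in> ring_of_integers K}"

definition ideal_coprime_to :: "real set \<Rightarrow> real set \<Rightarrow> nat \<Rightarrow> bool" where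
  "ideal_coprime_to K \<bb> q \<longleftrightarrow>
     {x + of_nat q * y | x y. x \<in> \<bb> \<and> y \<in> ring_of_integers K} = ring_of_integers K"

definition lattice2 :: "real \<Rightarrow> real \<Rightarrow> real set" where
  "lattice2 u v = {of_int i * u + of_int j * v | i j. True}"

definition frac1 :: "real \<Rightarrow> real" where
  "frac1 x = (if x \<in> \<int> then 1 else x - of_int \<lfloor>x\<rfloor>)"

definition int1 :: "real \<Rightarrow> real" where
  "int1 x = x - frac1 x"

definition residue1 :: "nat \<Rightarrow> int \<Rightarrow> int" where
  "residue1 q t = (THE u. 1 \<le> u \<and> u \<le> int q \<and> [u = t] (mod (int q)))"

definition B1 :: "real \<Rightarrow> real" where
  "B1 x = x - 1 / 2"

definition B2 :: "real \<Rightarrow> real" where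
  "B2 x = x\<^sup>2 - x + 1 / 6"

primrec plus_convergent :: "nat \<Rightarrow> (nat \<Rightarrow> real) \<Rightarrow> real" where
  "plus_convergent 0 a = a 0"
| "plus_convergent (Suc n) a = a 0 + 1 / plus_convergent n (\<lambda>i. a (Suc i))"

primrec minus_convergent :: "nat \<Rightarrow> (nat \<Rightarrow> real) \<Rightarrow> real" where
  "minus_convergent 0 b = b 0"
| "minus_convergent (Suc n) b = b 0 - 1 / minus_convergent n (\<lambda>i. b (Suc i))"

text \<open>
  Values of infinite continued fractions. They are only applied to periodic sequences, of
  positive integers in the first case and of integers \<open>\<ge> 2\<close> in the second,
  for which the convergents do converge.
\<close>

definition plus_cf :: "(nat \<Rightarrow> int) \<Rightarrow> real" where
  "plus_cf a = lim (\<lambda>n. plus_convergent n (\<lambda>i. of_int (a i)))"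

definition minus_cf :: "(nat \<Rightarrow> int) \<Rightarrow> real" where
  "minus_cf b = lim (\<lambda>n. minus_convergent n (\<lambda>i. of_int (b i)))"

text \<open>\<open>s_mu s\<close> is \<open>s \<cdot> \<mu>(s)\<close>, where \<open>\<mu>(s)\<close> is 1 for odd and 1/2 for even \<open>s\<close>.\<close>

definition s_mu :: "nat \<Rightarrow> nat" where
  "s_mu s = (if odd s then s else s div 2)"

text \<open>
  \<open>odd_sum a j = a 1 + a 3 + \<dots> + a (2j - 1)\<close> and \<open>minus_quotient a\<close> turn plus quotients into
  minus quotients. They give \<open>S\<close> and \<open>b\<close> when applied to the quotients \<open>a\<^sub>i(n)\<close>, and
  \<open>\<Gamma>\<close> and \<open>c\<close> when applied to their residues \<open>\<gamma>\<^sub>i(r)\<close>. As all these numbers are positive,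
  \<open>odd_sum a\<close> is injective and the description below is unambiguous.
\<close>

primrec odd_sum :: "(nat \<Rightarrow> int) \<Rightarrow> nat \<Rightarrow> int" where
  "odd_sum a 0 = 0"
| "odd_sum a (Suc j) = odd_sum a j + a (2 * j + 1)"

definition minus_quotient :: "(nat \<Rightarrow> int) \<Rightarrow> nat \<Rightarrow> int" where
  "minus_quotient a i =
     (if \<exists>j. int i = odd_sum a j then a (2 * (THE j. int i = odd_sum a j)) + 2 else 2)"

text \<open>The coefficients with index \<open>0, \<dots>, s - 1\<close> are extended with period \<open>s\<close>.\<close>

definition cyc :: "nat \<Rightarrow> (nat \<Rightarrow> int) \<Rightarrow> nat \<Rightarrow> int" where
  "cyc s f i = f (i mod s)"

definition quotient_at :: "nat \<Rightarrow> (nat \<Rightarrow> int) \<Rightarrow> (nat \<Rightarrow> int) \<Rightarrow> nat \<Rightarrow> nat \<Rightarrow> int" where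
  "quotient_at s \<alpha> \<beta> n i = cyc s \<alpha> i * int n + cyc s \<beta> i"

text \<open>In what follows \<open>a\<close> is the sequence \<open>a\<^sub>i(n)\<close> for a fixed \<open>n\<close>, and \<open>d\<close> stands for \<open>\<delta>(n)\<close>.\<close>

definition period_m :: "nat \<Rightarrow> (nat \<Rightarrow> int) \<Rightarrow> int" where
  "period_m s a = odd_sum a (s_mu s)"

definition b_seq :: "nat \<Rightarrow> (nat \<Rightarrow> int) \<Rightarrow> int \<Rightarrow> int" where
  "b_seq s a i =
     (if 0 \<le> i then minus_quotient a (nat i) else minus_quotient a (nat (i mod period_m s a)))"

definition delta_k :: "nat \<Rightarrow> (nat \<Rightarrow> int) \<Rightarrow> int \<Rightarrow> real" where
  "delta_k s a k = minus_cf (\<lambda>j. b_seq s a (k + int j))"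

text \<open>
  The two-sided sequence \<open>A\<^sub>k\<close>, with \<open>A\<^sub>-\<^sub>1 = d\<close>, \<open>A\<^sub>0 = 1\<close> and \<open>A\<^sub>k\<^sub>+\<^sub>1 = A\<^sub>k / \<delta>\<^sub>k\<^sub>+\<^sub>1\<close>: the value of \<open>A_up\<close>
  at \<open>j\<close> is \<open>A\<^sub>j\<close>, that of \<open>A_down\<close> at \<open>j\<close> is \<open>A\<^sub>-\<^sub>1\<^sub>-\<^sub>j\<close>, with the recursion solved for \<open>A\<^sub>k\<close>.
\<close>

primrec A_up :: "nat \<Rightarrow> (nat \<Rightarrow> int) \<Rightarrow> nat \<Rightarrow> real" where
  "A_up s a 0 = 1"
| "A_up s a (Suc j) = A_up s a j / delta_k s a (int j + 1)"

primrec A_down :: "nat \<Rightarrow> (nat \<Rightarrow> int) \<Rightarrow> real \<Rightarrow> nat \<Rightarrow> real" where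
  "A_down s a d 0 = d"
| "A_down s a d (Suc j) = A_down s a d j * delta_k s a (- 1 - int j)"

definition A_seq :: "nat \<Rightarrow> (nat \<Rightarrow> int) \<Rightarrow> real \<Rightarrow> int \<Rightarrow> real" where
  "A_seq s a d k = (if 0 \<le> k then A_up s a (nat k) else A_down s a d (nat (- 1 - k)))"

text \<open>
  The coordinates \<open>(x\<^sup>i, y\<^sup>i)\<close> of \<open>(C + D \<delta>(n)) / q\<close> modulo the lattice \<open>L\<close>. They are coordinates
  with respect to a basis of \<open>K\<close> over the rationals, hence rational; over the reals the pair
  would not be unique.
\<close>

definition xy_pair ::
  "nat \<Rightarrow> nat \<Rightarrow> (nat \<Rightarrow> int) \<Rightarrow> real set \<Rightarrow> real \<Rightarrow> int \<Rightarrow> int \<Rightarrow> int \<Rightarrow> real \<times> real" where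
  "xy_pair q s a L d C D i =
     (THE (x, y). x \<in> \<rat> \<and> y \<in> \<rat> \<and> 0 < x \<and> x \<le> 1 \<and> 0 \<le> y \<and> y < 1 \<and>
        x * A_seq s a d (i - 1) + y * A_seq s a d i
          \<in> {(of_int C + of_int D * d) / of_nat q + z | z. z \<in> L})"

definition x_coord ::
  "nat \<Rightarrow> nat \<Rightarrow> (nat \<Rightarrow> int) \<Rightarrow> real set \<Rightarrow> real \<Rightarrow> int \<Rightarrow> int \<Rightarrow> int \<Rightarrow> real" where
  "x_coord q s a L d C D i = fst (xy_pair q s a L d C D i)"

definition y_coord ::
  "nat \<Rightarrow> nat \<Rightarrow> (nat \<Rightarrow> int) \<Rightarrow> real set \<Rightarrow> real \<Rightarrow> int \<Rightarrow> int \<Rightarrow> int \<Rightarrow> real" where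
  "y_coord q s a L d C D i = snd (xy_pair q s a L d C D i)"

definition gamma_at :: "nat \<Rightarrow> nat \<Rightarrow> (nat \<Rightarrow> int) \<Rightarrow> (nat \<Rightarrow> int) \<Rightarrow> nat \<Rightarrow> nat \<Rightarrow> int" where
  "gamma_at q s \<alpha> \<beta> r i = residue1 q (quotient_at s \<alpha> \<beta> r i)"

text \<open>The division is exact, so that \<open>a\<^sub>i(r) = q \<tau>\<^sub>i(r) + \<gamma>\<^sub>i(r)\<close>.\<close>

definition tau_at :: "nat \<Rightarrow> nat \<Rightarrow> (nat \<Rightarrow> int) \<Rightarrow> (nat \<Rightarrow> int) \<Rightarrow> nat \<Rightarrow> nat \<Rightarrow> int" where
  "tau_at q s \<alpha> \<beta> r i = (quotient_at s \<alpha> \<beta> r i - gamma_at q s \<alpha> \<beta> r i) div int q"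

text \<open>
  In the next two definitions \<open>g\<close> is the sequence \<open>\<gamma>\<^sub>i(r)\<close>. The index of \<open>nu_shift\<close> is shifted by
  one, as the sequence \<open>\<nu>\<close> starts at \<open>-1\<close>.
\<close>

fun nu_shift :: "nat \<Rightarrow> (nat \<Rightarrow> int) \<Rightarrow> int \<Rightarrow> int \<Rightarrow> nat \<Rightarrow> real" where
  "nu_shift q g C D 0 = (of_nat q - of_int C) / of_nat q"
| "nu_shift q g C D (Suc 0) = frac1 (of_int D / of_nat q)"
| "nu_shift q g C D (Suc (Suc i)) =
     frac1 (of_int (minus_quotient g i) * nu_shift q g C D (Suc i) - nu_shift q g C D i)"

definition nu :: "nat \<Rightarrow> (nat \<Rightarrow> int) \<Rightarrow> int \<Rightarrow> int \<Rightarrow> int \<Rightarrow> real" where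
  "nu q g C D i = nu_shift q g C D (nat (i + 1))"

definition d_CD :: "nat \<Rightarrow> (nat \<Rightarrow> int) \<Rightarrow> int \<Rightarrow> int \<Rightarrow> nat \<Rightarrow> real" where
  "d_CD q g C D l = frac1 (nu q g C D (odd_sum g l + 1) - nu q g C D (odd_sum g l))"

definition A_CD ::
  "nat \<Rightarrow> nat \<Rightarrow> (nat \<Rightarrow> int) \<Rightarrow> (nat \<Rightarrow> int) \<Rightarrow> int \<Rightarrow> int \<Rightarrow> nat \<Rightarrow> real" where
  "A_CD q s \<alpha> \<beta> C D r =
    (let a = quotient_at s \<alpha> \<beta> r; \<gamma> = gamma_at q s \<alpha> \<beta> r; \<tau> = tau_at q s \<alpha> \<beta> r;
         \<Gamma> = odd_sum \<gamma>; \<nu> = nu q \<gamma> C D; d = d_CD q \<gamma> C D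
     in
       (\<Sum>l = 1..s_mu s.
          - 12 * B1 (\<nu> (\<Gamma> l)) * B1 (\<nu> (\<Gamma> l - 1))
          + 6 * (of_int (a (2 * l)) + 2) * B2 (\<nu> (\<Gamma> l)))
     + (\<Sum>l = 0..<s_mu s.
          6 * ((of_int (\<gamma> (2 * l + 1)) - 1) * (d l)\<^sup>2
               + (1 - 2 * d l) * int1 (\<nu> (\<Gamma> l) + d l * (of_int (\<gamma> (2 * l + 1)) - 1))
               + B2 (\<nu> (\<Gamma> (l + 1) - 1)) - B2 (\<nu> (\<Gamma> l)))
          - of_int (\<gamma> (2 * l + 1)) + 1
          + of_int (\<tau> (2 * l + 1)) *
              (6 * (of_nat q * (d l)\<^sup>2 + (1 - 2 * d l) * int1 (\<nu> (\<Gamma> l) + d l * of_nat q))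
               - of_nat q)))"

definition B_CD ::
  "nat \<Rightarrow> nat \<Rightarrow> (nat \<Rightarrow> int) \<Rightarrow> (nat \<Rightarrow> int) \<Rightarrow> int \<Rightarrow> int \<Rightarrow> nat \<Rightarrow> real" where
  "B_CD q s \<alpha> \<beta> C D r =
    (let \<gamma> = gamma_at q s \<alpha> \<beta> r; \<Gamma> = odd_sum \<gamma>; \<nu> = nu q \<gamma> C D; d = d_CD q \<gamma> C D
     in
       (\<Sum>l = 1..s_mu s. 6 * of_nat q * of_int (cyc s \<alpha> (2 * l)) * B2 (\<nu> (\<Gamma> l)))
     + (\<Sum>l = 0..<s_mu s.
          of_int (cyc s \<alpha> (2 * l + 1)) *
            (6 * (of_nat q * (d l)\<^sup>2 + (1 - 2 * d l) * int1 (\<nu> (\<Gamma> l) + d l * of_nat q))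
             - of_nat q)))"

end

theory Submission
  imports Defs
begin

text \<open>
  The recursion \<open>A\<^sub>i\<^sub>+\<^sub>1 = b\<^sub>i A\<^sub>i - A\<^sub>i\<^sub>-\<^sub>1\<close> gives \<open>x\<^sup>i\<^sup>+\<^sup>1 = \<langle>b\<^sub>i x\<^sup>i - x\<^sup>i\<^sup>-\<^sup>1\<rangle>\<close> and \<open>y\<^sup>i = 1 - x\<^sup>i\<^sup>-\<^sup>1\<close>, so the
  coordinates satisfy the recursion of \<open>\<nu>\<close>, with the quotients \<open>a\<^sub>i(n)\<close> in place of the residues
  \<open>\<gamma>\<^sub>i(r)\<close>. The minus quotients are 2 except at the indices \<open>S\<^sub>j\<close>; on each run of 2's the coordinate
  \<open>x\<^sup>i\<close> is an arithmetic progression modulo 1 with step in \<open>(1/q)\<int>\<close>. Hence its values at the ends of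
  the run depend only on the length of the run modulo \<open>q\<close>, and the sum over the run is evaluated by
  telescoping; it grows linearly with the number of full periods \<open>q\<close> in the run.
\<close>

section \<open>Fractional parts in (0, 1]\<close>

text \<open>The ceiling absorbs the special value at integers, so that later facts about
  \<open>frac1\<close> and \<open>int1\<close> need no case distinction.\<close>

lemma frac1_eq_ceiling: "frac1 x = x + 1 - of_int \<lceil>x\<rceil>"
proof (cases "x \<in> \<int>")
  case True
  then show ?thesis by (auto simp: frac1_def elim: Ints_cases)
next
  case False
  then have "x \<noteq> of_int \<lfloor>x\<rfloor>" by (metis Ints_of_int)
  with False show ?thesis by (simp add: frac1_def ceiling_altdef)
qed

lemma int1_eq_ceiling: "int1 x = of_int \<lceil>x\<rceil> - 1"
  by (simp add: int1_def frac1_eq_ceiling)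

lemma frac1_bounds: "0 < frac1 x" "frac1 x \<le> 1"
  by (simp_all add: frac1_eq_ceiling) linarith+

lemma frac1_eqI:
  assumes "0 < x" "x \<le> 1" "y - x \<in> \<int>"
  shows "frac1 y = x"
proof -
  obtain m where "y - x = of_int m"
    using assms(3) by (elim Ints_cases)
  then have y: "y = x + of_int m" by simp
  have "\<lceil>x\<rceil> = 1"
    using assms by (simp add: ceiling_unique)
  then show ?thesis
    by (simp add: frac1_eq_ceiling y)
qed

lemma frac1_diff_Ints: "x - frac1 x \<in> \<int>"
  by (simp add: frac1_eq_ceiling)

lemma frac1_cong:
  assumes "x - y \<in> \<int>"
  shows "frac1 x = frac1 y"
proof (rule frac1_eqI)
  have "x - frac1 y = (x - y) + (y - frac1 y)" by simp
  then show "x - frac1 y \<in> \<int>"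
    using assms frac1_diff_Ints by (metis Ints_add)
qed (simp_all add: frac1_bounds)

lemma int1_add_of_int: "int1 (x + of_int m) = int1 x + of_int m"
  by (simp add: int1_eq_ceiling)

lemma int1_eq_0: "0 < x \<Longrightarrow> x \<le> 1 \<Longrightarrow> int1 x = 0"
  using frac1_eqI[of x x] by (simp add: int1_def)

lemma int1_step:
  assumes "0 \<le> d" "d \<le> 1"
  shows "int1 (x + d) = int1 x \<or> int1 (x + d) = int1 x + 1"
proof -
  have "\<lceil>x + d\<rceil> = \<lceil>x\<rceil> \<or> \<lceil>x + d\<rceil> = \<lceil>x\<rceil> + 1"
    using assms by linarith
  then show ?thesis by (auto simp: int1_eq_ceiling)
qed

text \<open>
  The mechanism of the proof: \<open>(B2 u + B2 v) / 2 - B1 u * B1 v = (u - v)\<^sup>2 / 2 - 1 / 12\<close>, and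
  consecutive terms of an arithmetic progression modulo 1 differ by \<open>d\<close> or \<open>d - 1\<close>.
\<close>

lemma sum_progression:
  fixes x0 d :: real
  assumes "0 < x0" "x0 \<le> 1" "0 \<le> d" "d \<le> 1"
  shows "(\<Sum>t=1..p. 12 * B2 (frac1 (x0 + real t * d))
            - 12 * B1 (frac1 (x0 + real t * d)) * B1 (frac1 (x0 + real (t - 1) * d)))
    = 6 * (real p * d\<^sup>2 + (1 - 2 * d) * int1 (x0 + real p * d)
            + B2 (frac1 (x0 + real p * d)) - B2 x0) - real p"
proof (induction p)
  case 0
  have "frac1 x0 = x0"
    using assms by (intro frac1_eqI) auto
  then show ?case
    using assms by (simp add: int1_eq_0)
next
  case (Suc p)
  define u where "u = frac1 (x0 + real p * d)"
  define v where "v = frac1 (x0 + real (Suc p) * d)"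
  define e where "e = int1 (x0 + real (Suc p) * d) - int1 (x0 + real p * d)"
  have "x0 + real (Suc p) * d = (x0 + real p * d) + d"
    by (simp add: algebra_simps)
  then have "e = int1 (x0 + real p * d + d) - int1 (x0 + real p * d)"
    unfolding e_def by (rule arg_cong)
  then have "e = 0 \<or> e = 1"
    using int1_step[OF assms(3,4), of "x0 + real p * d"] by linarith
  \<comment> \<open>As \<open>e\<close> is 0 or 1, \<open>(d - e)\<^sup>2\<close> becomes linear in
    \<open>e\<close>. The increments \<open>e\<close> of \<open>int1\<close> then telescope.\<close>
  then have ee: "e\<^sup>2 = e" by auto
  have vu: "v = u + d - e"
    by (simp add: u_def v_def e_def int1_def algebra_simps)
  have "12 * B2 v - 12 * B1 v * B1 u = 6 * (v - u)\<^sup>2 - 1 + 6 * B2 v - 6 * B2 u"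
    by (simp add: B1_def B2_def power2_eq_square field_simps)
  also have "(v - u)\<^sup>2 = d\<^sup>2 + (1 - 2 * d) * e"
    using ee by (simp add: vu power2_eq_square algebra_simps)
  finally have step: "12 * B2 v - 12 * B1 v * B1 u
      = 6 * (d\<^sup>2 + (1 - 2 * d) * e) - 1 + 6 * B2 v - 6 * B2 u" .
  have "int1 (x0 + real (Suc p) * d) = int1 (x0 + real p * d) + e"
    by (simp add: e_def)
  then show ?case
    using Suc.IH step
    by (simp only: sum.cl_ivl_Suc u_def[symmetric] v_def[symmetric] diff_Suc_1)
       (simp add: algebra_simps)
qed

section \<open>Plus continued fractions\<close>

lemma plus_convergent_bounds:
  assumes "\<And>i. 1 \<le> a i"
  shows "a 0 \<le> plus_convergent n a" "plus_convergent n a \<le> a 0 + 1"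
proof -
  have "a 0 \<le> plus_convergent n a \<and> plus_convergent n a \<le> a 0 + 1"
    using assms
  proof (induction n arbitrary: a)
    case (Suc n)
    have "a 1 \<le> plus_convergent n (\<lambda>i. a (Suc i))"
      using Suc.IH[of "\<lambda>i. a (Suc i)"] Suc.prems by simp
    with Suc.prems[of 1] have "1 \<le> plus_convergent n (\<lambda>i. a (Suc i))"
      by linarith
    then show ?case by (simp add: field_simps)
  qed simp
  then show "a 0 \<le> plus_convergent n a" "plus_convergent n a \<le> a 0 + 1" by auto
qed

text \<open>A single inversion contracts by no fixed factor near 1. Two of them form a map of
  determinant 1 whose denominators \<open>c * y + 1\<close> are at least 2, which gives the factor
  1/4.\<close>

lemma two_step_contraction:
  fixes c y y' :: real
  assumes "1 \<le> c" "1 \<le> y" "1 \<le> y'"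
  shows "\<bar>1 / (c + 1 / y) - 1 / (c + 1 / y')\<bar> \<le> \<bar>y - y'\<bar> / 4"
proof -
  have 1: "2 \<le> c * y + 1" "2 \<le> c * y' + 1"
    using mult_mono[of 1 c 1 y] mult_mono[of 1 c 1 y'] assms by auto
  have "1 / (c + 1 / y) = y / (c * y + 1)" "1 / (c + 1 / y') = y' / (c * y' + 1)"
    using assms by (auto simp: field_simps)
  then have "1 / (c + 1 / y) - 1 / (c + 1 / y') = y / (c * y + 1) - y' / (c * y' + 1)"
    by simp
  also have "\<dots> = (y - y') / ((c * y + 1) * (c * y' + 1))"
    using 1 by (simp add: divide_simps) (simp add: algebra_simps)
  finally have "\<bar>1 / (c + 1 / y) - 1 / (c + 1 / y')\<bar> = \<bar>y - y'\<bar> / ((c * y + 1) * (c * y' + 1))"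
    using 1 by (simp add: abs_mult)
  also have "\<dots> \<le> \<bar>y - y'\<bar> / 4"
    using mult_mono[OF 1] 1 by (intro divide_left_mono) auto
  finally show ?thesis .
qed

text \<open>Any two convergents lie in an interval of length 1, and each of the \<open>k\<close>
  pairs of common leading quotients divides the distance by 4.\<close>

lemma plus_convergent_diff:
  assumes "\<And>i. 1 \<le> a i" "2 * k \<le> n" "2 * k \<le> m"
  shows "\<bar>plus_convergent n a - plus_convergent m a\<bar> \<le> (1 / 4) ^ k"
  using assms
proof (induction k arbitrary: n m a)
  case 0
  then show ?case
    using plus_convergent_bounds[of a n] plus_convergent_bounds[of a m] by simp
next
  case (Suc k)
  define n' m' where "n' = n - 2" and "m' = m - 2"
  then have nm: "n = Suc (Suc n')" "m = Suc (Suc m')"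
    using Suc.prems by simp_all
  let ?a = "\<lambda>i. a (Suc (Suc i))"
  have pos: "1 \<le> plus_convergent j ?a" for j
    using plus_convergent_bounds(1)[of ?a j] Suc.prems(1) order_trans[OF Suc.prems(1)[of 2]]
    by (simp add: numeral_2_eq_2)
  have "\<bar>plus_convergent n a - plus_convergent m a\<bar>
      \<le> \<bar>plus_convergent n' ?a - plus_convergent m' ?a\<bar> / 4"
    using two_step_contraction[OF Suc.prems(1)[of 1] pos[of n'] pos[of m']]
    by (simp add: nm)
  also have "\<dots> \<le> (1 / 4) ^ k / 4"
    using Suc.IH[of ?a n' m'] Suc.prems nm by simp
  finally show ?case by simp
qed

lemma plus_cf_LIMSEQ:
  assumes "\<And>i. 0 < a i"
  shows "(\<lambda>n. plus_convergent n (\<lambda>i. of_int (a i))) \<longlonglongrightarrow> plus_cf a"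
proof -
  let ?a = "\<lambda>i. real_of_int (a i)"
  have pos: "1 \<le> ?a i" for i
    using assms[of i] by simp
  have "Cauchy (\<lambda>n. plus_convergent n ?a)"
  proof (rule metric_CauchyI)
    fix e :: real
    assume "0 < e"
    then obtain k where k: "(1 / 4 :: real) ^ k < e"
      using real_arch_pow_inv[of e "1 / 4"] by auto
    have "dist (plus_convergent m ?a) (plus_convergent n ?a) < e"
      if "2 * k \<le> m" "2 * k \<le> n" for m n
      using plus_convergent_diff[of ?a k m n, OF pos that] k by (simp add: dist_real_def)
    then show "\<exists>M. \<forall>m\<ge>M. \<forall>n\<ge>M. dist (plus_convergent m ?a) (plus_convergent n ?a) < e"
      by blast
  qed
  then show ?thesis
    unfolding plus_cf_def by (simp add: Cauchy_convergent_iff convergent_LIMSEQ_iff)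
qed

lemma plus_cf_ge:
  assumes "\<And>i. 0 < a i"
  shows "of_int (a 0) \<le> plus_cf a"
proof (rule LIMSEQ_le_const[OF plus_cf_LIMSEQ])
  have "1 \<le> real_of_int (a i)" for i
    using assms[of i] by simp
  then show "\<exists>N. \<forall>n\<ge>N. of_int (a 0) \<le> plus_convergent n (\<lambda>i. of_int (a i))"
    using plus_convergent_bounds(1)[of "\<lambda>i. of_int (a i)"] by blast
qed (rule assms)

lemma plus_cf_rec:
  assumes "\<And>i. 0 < a i"
  shows "plus_cf a = of_int (a 0) + 1 / plus_cf (\<lambda>i. a (Suc i))"
proof -
  let ?x = "plus_cf (\<lambda>i. a (Suc i))"
  have "?x \<noteq> 0"
    using plus_cf_ge[of "\<lambda>i. a (Suc i)"] assms[of 1] assms by fastforce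
  then have "(\<lambda>n. of_int (a 0) + 1 / plus_convergent n (\<lambda>i. of_int (a (Suc i))))
      \<longlonglongrightarrow> of_int (a 0) + 1 / ?x"
    using plus_cf_LIMSEQ[of "\<lambda>i. a (Suc i)"] assms by (intro tendsto_intros) auto
  then have "(\<lambda>n. plus_convergent (Suc n) (\<lambda>i. of_int (a i))) \<longlonglongrightarrow> of_int (a 0) + 1 / ?x"
    by simp
  then have "(\<lambda>n. plus_convergent n (\<lambda>i. of_int (a i))) \<longlonglongrightarrow> of_int (a 0) + 1 / ?x"
    by (rule LIMSEQ_imp_Suc)
  then show ?thesis
    using plus_cf_LIMSEQ[OF assms] by (rule LIMSEQ_unique[rotated])
qed

lemma plus_cf_gt_1:
  assumes "\<And>i. 0 < a i"
  shows "1 < plus_cf a"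
proof -
  have pos: "1 \<le> real_of_int (a i)" for i
    using assms[of i] by simp
  have "1 \<le> plus_cf (\<lambda>i. a (Suc i))"
    using order_trans[OF pos plus_cf_ge[of "\<lambda>i. a (Suc i)"]] assms by simp
  then have "0 < 1 / plus_cf (\<lambda>i. a (Suc i))" by simp
  then show ?thesis
    unfolding plus_cf_rec[of a, OF assms] using pos[of 0] by linarith
qed

text \<open>Infinite descent on the denominator, as in the Euclidean algorithm: if the value is
  \<open>p / r\<close>, then the next complete quotient is \<open>r / w\<close> with the remainder
  \<open>w = p - a 0 * r\<close>, and \<open>0 < w < r\<close>.\<close>

lemma plus_cf_irrational:
  assumes "\<And>i. 0 < a i"
  shows "plus_cf a \<notin> \<rat>"
proof
  assume "plus_cf a \<in> \<rat>"
  then obtain p r' :: int where "0 < r'" "plus_cf a = of_int p / of_int r'"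
    by (elim Rats_cases')
  then obtain r where "0 < r" "plus_cf a = of_int p / of_nat r"
    by (metis of_int_of_nat_eq of_nat_0_less_iff zero_less_imp_eq_int)
  then show False
    using assms
  proof (induction r arbitrary: p a rule: less_induct)
    case (less r)
    let ?x = "plus_cf (\<lambda>i. a (Suc i))"
    have x: "1 < ?x"
      using less.prems by (intro plus_cf_gt_1) auto
    have eq: "of_int p / of_nat r - of_int (a 0) = 1 / ?x"
      using plus_cf_rec[of a] less.prems by simp
    define w where "w = p - a 0 * int r"
    have w: "of_int w = real r / ?x"
      using eq less.prems(1) by (simp add: w_def field_simps)
    have "0 < real_of_int w" "real_of_int w < real_of_int (int r)"
      using x less.prems(1) by (auto simp: w field_simps)
    then have "0 < w" "nat w < r"
      by (simp_all only: of_int_less_iff of_int_0_less_iff nat_less_iff)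
    moreover have "?x = of_int (int r) / of_nat (nat w)"
      using w x \<open>0 < w\<close> by (simp add: field_simps)
    ultimately show False
      using less.IH[of "nat w" "\<lambda>i. a (Suc i)" "int r"] less.prems by simp
  qed
qed

section \<open>Minus continued fractions\<close>

text \<open>An error e of the tail becomes e / (w c) with c = w + e and w at least 1, hence at most
  e / (1 + e). This map sends 1 / (n + 1) to 1 / (n + 2). The bound is attained when all quotients
  are 2 and all \<open>z i\<close> are 1.\<close>

lemma minus_convergent_error:
  fixes b z :: "nat \<Rightarrow> real"
  assumes "\<And>i. z i = b i - 1 / z (Suc i)" "\<And>i. 1 \<le> z i"
  shows "0 \<le> minus_convergent n b - z 0"
    and "minus_convergent n b - z 0 \<le> 1 / (real n + 1)"
proof -
  have "0 \<le> minus_convergent n b - z 0 \<and> minus_convergent n b - z 0 \<le> 1 / (real n + 1)"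
    using assms
  proof (induction n arbitrary: b z)
    case 0
    have "b 0 - z 0 = 1 / z 1"
      using 0(1)[of 0] by simp
    then show ?case
      using 0(2)[of 1] by simp
  next
    case (Suc n)
    define c where "c = minus_convergent n (\<lambda>i. b (Suc i))"
    define w where "w = z 1"
    have w: "1 \<le> w"
      using Suc.prems(2) by (simp add: w_def)
    have c: "0 \<le> c - w" "c - w \<le> 1 / (real n + 1)"
      using Suc.IH[of "\<lambda>i. z (Suc i)" "\<lambda>i. b (Suc i)", OF Suc.prems]
      by (simp_all add: c_def w_def)
    have eq: "minus_convergent (Suc n) b - z 0 = 1 / w - 1 / c"
      using Suc.prems(1)[of 0] by (simp add: c_def w_def)
    also have "\<dots> = (c - w) / (w * c)"
      using w c by (simp add: field_simps)
    also have "\<dots> \<le> (c - w) / (1 + (c - w))"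
    proof (rule divide_left_mono)
      have "1 * c \<le> w * c"
        using w c by (intro mult_right_mono) auto
      then show "1 + (c - w) \<le> w * c"
        using w by linarith
    qed (use w c in auto)
    also have "\<dots> \<le> 1 / (real (Suc n) + 1)"
    proof -
      have "(c - w) * (real n + 1) \<le> 1"
        using c(2) by (simp add: pos_le_divide_eq)
      then have "(c - w) * (real (Suc n) + 1) \<le> 1 * (1 + (c - w))"
        by (simp add: algebra_simps)
      then have "(c - w) \<le> (1 + (c - w)) / (real (Suc n) + 1)"
        by (simp add: pos_le_divide_eq)
      then show ?thesis
        using c(1) by (simp add: pos_divide_le_eq)
    qed
    finally have "minus_convergent (Suc n) b - z 0 \<le> 1 / (real (Suc n) + 1)" .
    moreover have "0 \<le> 1 / w - 1 / c"
      using w c by (simp add: frac_le)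
    ultimately show ?case
      by (simp only: eq simp_thms)
  qed
  then show "0 \<le> minus_convergent n b - z 0"
    and "minus_convergent n b - z 0 \<le> 1 / (real n + 1)" by auto
qed

text \<open>Gives convergence and the limit at once: it suffices to exhibit a solution of the
  recursion that stays at least 1.\<close>

lemma minus_cf_eqI:
  fixes b :: "nat \<Rightarrow> int" and z :: "nat \<Rightarrow> real"
  assumes "\<And>i. z i = of_int (b i) - 1 / z (Suc i)" "\<And>i. 1 \<le> z i"
  shows "minus_cf b = z 0"
proof -
  have "(\<lambda>n. minus_convergent n (\<lambda>i. of_int (b i)) - z 0) \<longlonglongrightarrow> 0"
  proof (rule tendsto_sandwich[where f = "\<lambda>_. 0" and h = "\<lambda>n. 1 / (real n + 1)"])
    show "(\<lambda>n. 1 / (real n + 1)) \<longlonglongrightarrow> 0"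
      using LIMSEQ_inverse_real_of_nat by (simp add: inverse_eq_divide add.commute)
    show "\<forall>\<^sub>F n in sequentially. 0 \<le> minus_convergent n (\<lambda>i. of_int (b i)) - z 0"
      by (intro always_eventually allI minus_convergent_error(1)[of z "\<lambda>i. of_int (b i)", OF assms])
    show "\<forall>\<^sub>F n in sequentially. minus_convergent n (\<lambda>i. of_int (b i)) - z 0 \<le> 1 / (real n + 1)"
      by (intro always_eventually allI minus_convergent_error(2)[of z "\<lambda>i. of_int (b i)", OF assms])
  qed simp
  then show ?thesis
    unfolding minus_cf_def by (rule limI[OF LIM_zero_cancel])
qed

section \<open>Runs of minus quotients\<close>

lemma odd_sum_less_iff:
  assumes "\<And>i. 0 < a i"
  shows "odd_sum a i < odd_sum a j \<longleftrightarrow> i < j"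
proof -
  have "strict_mono (odd_sum a)"
    using assms by (simp add: strict_mono_Suc_iff)
  then show ?thesis by (rule strict_mono_less)
qed

lemma odd_sum_nonneg:
  assumes "\<And>i. 0 < a i"
  shows "0 \<le> odd_sum a j"
  using odd_sum_less_iff[of a j 0, OF assms] by simp

lemma minus_quotient_odd_sum:
  assumes "\<And>i. 0 < a i" "int i = odd_sum a j"
  shows "minus_quotient a i = a (2 * j) + 2"
proof -
  have "odd_sum a j = odd_sum a j' \<longleftrightarrow> j = j'" for j'
    using odd_sum_less_iff[of a j j'] odd_sum_less_iff[of a j' j] assms(1)
    by (metis less_irrefl linorder_neqE)
  then have "(THE j. int i = odd_sum a j) = j"
    using assms(2) by auto
  then show ?thesis
    using assms(2) by (auto simp: minus_quotient_def)
qed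

lemma minus_quotient_inside:
  assumes "\<And>i. 0 < a i" "odd_sum a j < int i" "int i < odd_sum a (Suc j)"
  shows "minus_quotient a i = 2"
proof -
  have "int i \<noteq> odd_sum a j'" for j'
    using assms odd_sum_less_iff[of a j j'] odd_sum_less_iff[of a j' "Suc j"] by auto
  then show ?thesis by (simp add: minus_quotient_def)
qed

lemma odd_sum_decompose:
  assumes "\<And>i. 0 < a i"
  obtains j t where "int i = odd_sum a j + int t" "int t < a (2 * j + 1)"
proof -
  have "\<exists>j t. int i = odd_sum a j + int t \<and> int t < a (2 * j + 1)"
  proof (induction i)
    case 0
    have "int 0 = odd_sum a 0 + int 0 \<and> int 0 < a (2 * 0 + 1)"
      using assms by simp
    then show ?case by blast
  next
    case (Suc i)
    then obtain j t where jt: "int i = odd_sum a j + int t" "int t < a (2 * j + 1)" by blast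
    show ?case
    proof (cases "int (Suc t) < a (2 * j + 1)")
      case True
      then have "int (Suc i) = odd_sum a j + int (Suc t) \<and> int (Suc t) < a (2 * j + 1)"
        using jt by simp
      then show ?thesis by blast
    next
      case False
      then have "int (Suc i) = odd_sum a (Suc j) + int 0 \<and> int 0 < a (2 * Suc j + 1)"
        using jt assms by simp
      then show ?thesis by blast
    qed
  qed
  then show ?thesis using that by blast
qed

text \<open>Each run is open on the left and closed on the right. Its last index, where the minus
  quotient differs from 2, is split off.\<close>

lemma sum_over_runs:
  fixes F :: "int \<Rightarrow> real"
  assumes "\<And>i. 0 < a i"
  shows "(\<Sum>i=1..odd_sum a J. F i)
    = (\<Sum>l=0..<J. (\<Sum>t=1..nat (a (2 * l + 1)) - 1. F (odd_sum a l + int t))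
        + F (odd_sum a (Suc l)))"
proof (induction J)
  case (Suc J)
  have extend: "(\<Sum>i=1..odd_sum a J + int h. F i)
      = (\<Sum>i=1..odd_sum a J. F i) + (\<Sum>t=1..h. F (odd_sum a J + int t))" for h
  proof (induction h)
    case (Suc h)
    have "{1..odd_sum a J + int (Suc h)}
        = insert (odd_sum a J + int (Suc h)) {1..odd_sum a J + int h}"
      using odd_sum_nonneg[of a J] assms by auto
    then show ?case
      using Suc by simp
  qed simp
  obtain h where h: "a (2 * J + 1) = int (Suc h)"
    using assms[of "2 * J + 1"] by (metis pos_int_cases gr0_implies_Suc)
  have "(\<Sum>i=1..odd_sum a (Suc J). F i)
      = (\<Sum>i=1..odd_sum a J. F i) + (\<Sum>t=1..Suc h. F (odd_sum a J + int t))"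
    using extend[of "Suc h"] h by simp
  also have "\<dots> = (\<Sum>i=1..odd_sum a J. F i)
      + ((\<Sum>t=1..nat (a (2 * J + 1)) - 1. F (odd_sum a J + int t)) + F (odd_sum a (Suc J)))"
    using h by (simp add: nat_add_distrib)
  finally show ?case
    using Suc by simp
qed simp

section \<open>From plus to minus continued fractions\<close>

text \<open>The recursion \<open>z i = b i - 1 / z (Suc i)\<close> of complete quotients, solved for
  the later term. Started at a value known from the plus fraction, it provides candidates for
  \<open>delta_k\<close> without any limit of minus convergents.\<close>

primrec minus_tail :: "(nat \<Rightarrow> int) \<Rightarrow> real \<Rightarrow> nat \<Rightarrow> real" where
  "minus_tail b d 0 = d"
| "minus_tail b d (Suc i) = 1 / (of_int (b i) - minus_tail b d i)"

text \<open>
  The quotients 2 come from \<open>(y + 1) / y = 2 - 1 / (y / (y - 1))\<close>, iterated as long as \<open>y > 1\<close>.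
\<close>

lemma minus_tail_values:
  assumes pos: "\<And>i. 0 < a i"
  defines "X \<equiv> \<lambda>i. plus_cf (\<lambda>j. a (i + j))"
    and "z \<equiv> minus_tail (minus_quotient a) (plus_cf a + 1)"
  shows "int i = odd_sum a j \<Longrightarrow> z i = X (2 * j) + 1"
    and "int i = odd_sum a j + int t \<Longrightarrow> 1 \<le> t \<Longrightarrow> int t \<le> a (2 * j + 1) \<Longrightarrow>
      z i = (X (2 * j + 1) - real t + 1) / (X (2 * j + 1) - real t)"
proof -
  have rec: "X i = of_int (a i) + 1 / X (Suc i)" for i
    using plus_cf_rec[of "\<lambda>j. a (i + j)"] pos by (simp add: X_def)
  have gt1: "1 < X i" for i
    using plus_cf_gt_1[of "\<lambda>j. a (i + j)"] pos by (simp add: X_def)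
  have gt: "of_int (a i) < X i" for i
    using rec[of i] gt1[of "Suc i"] by simp
  \<comment> \<open>The value at the start of run \<open>j\<close> is a premise here, because the
    two claims depend on each other: this formula at \<open>t = a (2 * j + 1)\<close> supplies the
    start of run \<open>j + 1\<close> in the induction below.\<close>
  have inside: "z i = (X (2 * j + 1) - real t + 1) / (X (2 * j + 1) - real t)"
    if start: "\<And>i. int i = odd_sum a j \<Longrightarrow> z i = X (2 * j) + 1"
      and "int i = odd_sum a j + int t" "1 \<le> t" "int t \<le> a (2 * j + 1)" for i j t
    using that(2-)
  proof (induction t arbitrary: i)
    case (Suc t)
    let ?Y = "X (2 * j + 1)"
    obtain i' where i: "i = Suc i'"
      using Suc.prems odd_sum_nonneg[of a j] pos by (cases i) auto
    have Y: "real t + 1 < ?Y"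
      using gt[of "2 * j + 1"] Suc.prems(3) by linarith
    show ?case
    proof (cases "t = 0")
      case True
      have i': "int i' = odd_sum a j"
        using True Suc.prems i by simp
      have "z i = 1 / (of_int (a (2 * j)) + 2 - (X (2 * j) + 1))"
        using start[OF i'] minus_quotient_odd_sum[OF pos i'] by (simp add: i z_def)
      also have "\<dots> = 1 / (1 - 1 / ?Y)"
        using rec[of "2 * j"] by simp
      also have "\<dots> = ?Y / (?Y - 1)"
        using Y True by (simp add: field_simps)
      finally show ?thesis
        using True by simp
    next
      case False
      have "z i' = (?Y - real t + 1) / (?Y - real t)"
        using Suc.IH[of i'] Suc.prems False i by simp
      moreover have "minus_quotient a i' = 2"
        using minus_quotient_inside[of a j i'] pos Suc.prems i False by simp
      ultimately have "z i = 1 / (2 - (?Y - real t + 1) / (?Y - real t))"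
        by (simp add: i z_def)
      also have "\<dots> = (?Y - real (Suc t) + 1) / (?Y - real (Suc t))"
        using Y by (simp add: field_simps)
      finally show ?thesis .
    qed
  qed simp
  show start: "z i = X (2 * j) + 1" if "int i = odd_sum a j" for i j
    using that
  proof (induction j arbitrary: i)
    case 0
    then show ?case by (simp add: z_def X_def)
  next
    case (Suc j)
    define t where "t = nat (a (2 * j + 1))"
    have t: "int t = a (2 * j + 1)" "1 \<le> t" "real t = of_int (a (2 * j + 1))"
      using pos[of "2 * j + 1"] by (simp_all add: t_def)
    have "z i = (X (2 * j + 1) - real t + 1) / (X (2 * j + 1) - real t)"
      using Suc.prems t by (intro inside[OF Suc.IH]) auto
    also have "X (2 * j + 1) - real t = 1 / X (2 * Suc j)"
      using rec[of "2 * j + 1"] t by simp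
    also have "(1 / X (2 * Suc j) + 1) / (1 / X (2 * Suc j)) = X (2 * Suc j) + 1"
      using gt1[of "2 * Suc j"] by (simp add: field_simps)
    finally show ?case .
  qed
  show "int i = odd_sum a j + int t \<Longrightarrow> 1 \<le> t \<Longrightarrow> int t \<le> a (2 * j + 1) \<Longrightarrow>
      z i = (X (2 * j + 1) - real t + 1) / (X (2 * j + 1) - real t)"
    by (rule inside[OF start])
qed

text \<open>At the start of a run the value is X + 1, inside it is (y + 1) / y with y = X - t
  positive. The bound rules out division by zero in the recursion and makes
  \<open>minus_cf_eqI\<close> applicable.\<close>

lemma minus_tail_gt_1:
  assumes "\<And>i. 0 < a i"
  shows "1 < minus_tail (minus_quotient a) (plus_cf a + 1) i"
proof -
  obtain j t where jt: "int i = odd_sum a j + int t" "int t < a (2 * j + 1)"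
    using odd_sum_decompose[of a i] assms by blast
  have gt: "of_int (a (2 * j + 1)) \<le> plus_cf (\<lambda>k. a (2 * j + 1 + k))"
    using plus_cf_ge[of "\<lambda>k. a (2 * j + 1 + k)"] assms by simp
  have "1 < plus_cf (\<lambda>k. a (2 * j + k))"
    using assms by (intro plus_cf_gt_1) auto
  moreover have "real t < plus_cf (\<lambda>k. a (2 * j + 1 + k))"
    using gt jt(2) by linarith
  ultimately show ?thesis
    using minus_tail_values(1)[of a i j] minus_tail_values(2)[of a i j t] jt assms
    by (cases "t = 0") (auto simp: less_divide_eq)
qed

lemma minus_tail_rec:
  assumes "\<And>i. 0 < a i"
  defines "z \<equiv> minus_tail (minus_quotient a) (plus_cf a + 1)"
  shows "z i = of_int (minus_quotient a i) - 1 / z (Suc i)"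
  using minus_tail_gt_1[of a "Suc i"] assms(1) by (simp add: z_def)

text \<open>Irrationality of the plus fraction passes along the recursion. It makes consecutive
  members of \<open>A_seq\<close> linearly independent over the rationals.\<close>

lemma minus_tail_irrational:
  assumes "\<And>i. 0 < a i"
  shows "minus_tail (minus_quotient a) (plus_cf a + 1) i \<notin> \<rat>"
proof (induction i)
  case 0
  show ?case
    using plus_cf_irrational[of a] assms Rats_diff[of "plus_cf a + 1" 1] by auto
next
  case (Suc i)
  show ?case
  proof
    assume "minus_tail (minus_quotient a) (plus_cf a + 1) (Suc i) \<in> \<rat>"
    then have "of_int (minus_quotient a i)
        - 1 / minus_tail (minus_quotient a) (plus_cf a + 1) (Suc i) \<in> \<rat>"
      by (intro Rats_diff Rats_divide) auto
    then show False
      using Suc by (simp only: minus_tail_rec[of a i, OF assms, symmetric])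
  qed
qed

lemma delta_k_eq_minus_tail:
  assumes "\<And>i. 0 < a i"
  shows "delta_k s a (int k) = minus_tail (minus_quotient a) (plus_cf a + 1) k"
proof -
  let ?z = "minus_tail (minus_quotient a) (plus_cf a + 1)"
  have "minus_cf (\<lambda>j. minus_quotient a (k + j)) = ?z (k + 0)"
  proof (rule minus_cf_eqI)
    show "?z (k + i) = of_int (minus_quotient a (k + i)) - 1 / ?z (k + Suc i)" for i
      using minus_tail_rec[of a "k + i", OF assms] by (simp only: add_Suc_right)
    show "1 \<le> ?z (k + i)" for i
      using minus_tail_gt_1[of a "k + i"] assms by simp
  qed
  moreover have "nat (int k + int j) = k + j" for j
    by simp
  ultimately show ?thesis
    by (simp add: delta_k_def b_seq_def)
qed

section \<open>Coordinates with respect to consecutive bases\<close>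

lemma lattice2_add: "x \<in> lattice2 u v \<Longrightarrow> y \<in> lattice2 u v \<Longrightarrow> x + y \<in> lattice2 u v"
proof -
  assume "x \<in> lattice2 u v" "y \<in> lattice2 u v"
  then obtain i j k l where "x = of_int i * u + of_int j * v" "y = of_int k * u + of_int l * v"
    by (auto simp: lattice2_def)
  then have "x + y = of_int (i + k) * u + of_int (j + l) * v"
    by (simp add: algebra_simps)
  then show ?thesis unfolding lattice2_def by blast
qed

lemma lattice2_diff: "x \<in> lattice2 u v \<Longrightarrow> y \<in> lattice2 u v \<Longrightarrow> x - y \<in> lattice2 u v"
proof -
  assume "x \<in> lattice2 u v" "y \<in> lattice2 u v"
  then obtain i j k l where "x = of_int i * u + of_int j * v" "y = of_int k * u + of_int l * v"
    by (auto simp: lattice2_def)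
  then have "x - y = of_int (i - k) * u + of_int (j - l) * v"
    by (simp add: algebra_simps)
  then show ?thesis unfolding lattice2_def by blast
qed

lemma lattice2_commute: "lattice2 u v = lattice2 v u"
proof -
  have "lattice2 u v \<subseteq> lattice2 v u" for u v
  proof
    fix x
    assume "x \<in> lattice2 u v"
    then obtain i j where "x = of_int i * u + of_int j * v"
      by (auto simp: lattice2_def)
    then have "x = of_int j * v + of_int i * u" by simp
    then show "x \<in> lattice2 v u"
      unfolding lattice2_def by blast
  qed
  then show ?thesis by blast
qed

text \<open>The change of basis is unimodular, and it has the same shape as its inverse: applied to
  \<open>of_int c * v - u\<close> in place of \<open>u\<close> it returns \<open>u\<close>. So one
  inclusion, used twice, suffices.\<close>

lemma lattice2_step: "lattice2 v (of_int c * v - u) = lattice2 u v"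
proof -
  have "lattice2 v (of_int c * v - u) \<subseteq> lattice2 u v" for u
  proof
    fix x
    assume "x \<in> lattice2 v (of_int c * v - u)"
    then obtain i j where "x = of_int i * v + of_int j * (of_int c * v - u)"
      by (auto simp: lattice2_def)
    then have "x = of_int (- j) * u + of_int (i + j * c) * v"
      by (simp add: algebra_simps)
    then show "x \<in> lattice2 u v"
      by (auto simp only: lattice2_def)
  qed
  from this[of u] this[of "of_int c * v - u"] show ?thesis
    by (auto simp: lattice2_commute)
qed

text \<open>An irrational ratio means independence over the rationals, so rational coordinates of a
  lattice point are the integral ones. Uniqueness of the pair in \<open>xy_pair\<close> rests on
  this.\<close>

lemma lattice2_coordinates:
  assumes "v \<noteq> 0" "u / v \<notin> \<rat>" "x \<in> \<rat>" "y \<in> \<rat>" "x * u + y * v \<in> lattice2 u v"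
  shows "x \<in> \<int>" "y \<in> \<int>"
proof -
  obtain i j where "x * u + y * v = of_int i * u + of_int j * v"
    using assms(5) by (auto simp: lattice2_def)
  then have eq: "(x - of_int i) * (u / v) = of_int j - y"
    using assms(1) by (simp add: field_simps)
  have "x = of_int i"
  proof (rule ccontr)
    assume "x \<noteq> of_int i"
    then have "u / v = (of_int j - y) / (x - of_int i)"
      using eq by (simp add: field_simps)
    also have "\<dots> \<in> \<rat>"
      using assms by (intro Rats_divide Rats_diff) auto
    finally show False
      using assms(2) by contradiction
  qed
  then show "x \<in> \<int>" "y \<in> \<int>"
    using eq by auto
qed

section \<open>Range and denominators of the sequence \<nu>\<close>

lemma nu_shift_bounds: "0 < nu_shift q g C D (Suc i)" "nu_shift q g C D (Suc i) \<le> 1"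
  by (cases i; simp add: frac1_bounds)+

lemma frac1_mult_Ints: "of_nat q * x \<in> \<int> \<Longrightarrow> of_nat q * frac1 x \<in> \<int>"
  by (simp add: frac1_eq_ceiling algebra_simps)

text \<open>All terms have denominator dividing \<open>q\<close>. This is why changing a quotient by
  a multiple of \<open>q\<close> has no effect modulo 1.\<close>

lemma nu_shift_Ints:
  assumes "q > 0"
  shows "of_nat q * nu_shift q g C D i \<in> \<int>"
proof (induction q g C D i rule: nu_shift.induct)
  case (3 q g C D i)
  have "of_nat q * (of_int (minus_quotient g i) * nu_shift q g C D (Suc i) - nu_shift q g C D i)
      = of_int (minus_quotient g i) * (of_nat q * nu_shift q g C D (Suc i))
        - of_nat q * nu_shift q g C D i"
    by (simp add: algebra_simps)
  also have "\<dots> \<in> \<int>"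
    by (intro Ints_diff Ints_mult[OF Ints_of_int] 3)
  finally show ?case
    by (simp add: frac1_mult_Ints)
qed (use assms in \<open>auto intro!: frac1_mult_Ints\<close>)

lemma nu_shift_Rats:
  assumes "q > 0"
  shows "nu_shift q g C D i \<in> \<rat>"
proof -
  have "of_nat q * nu_shift q g C D i / of_nat q \<in> \<rat>"
    using nu_shift_Ints[OF assms] Ints_subset_Rats by (intro Rats_divide) auto
  then show ?thesis
    using assms by simp
qed

text \<open>The index is shifted so that \<open>P 0\<close> is \<open>d\<close>. Ratios of
  consecutive members are the complete quotients; clearing denominators in their recursion yields a
  linear one with integer coefficients, as \<open>lattice2_step\<close> requires.\<close>

lemma A_seq_step:
  fixes a :: "nat \<Rightarrow> int" and s :: nat
  assumes pos: "\<And>i. 0 < a i"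
  defines "d \<equiv> plus_cf a + 1" and "P \<equiv> \<lambda>i. A_seq s a (plus_cf a + 1) (int i - 1)"
  shows "P (Suc i) > 0" "P i = minus_tail (minus_quotient a) d i * P (Suc i)"
    "P (Suc (Suc i)) = of_int (minus_quotient a i) * P (Suc i) - P i"
proof -
  let ?z = "minus_tail (minus_quotient a) d"
  have z: "1 < ?z i" for i
    using minus_tail_gt_1[of a i, OF pos] by (simp add: d_def)
  have up: "P (Suc i) = A_up s a i" for i
    by (simp add: P_def A_seq_def)
  have up_Suc: "A_up s a (Suc i) = A_up s a i / ?z (Suc i)" for i
    using delta_k_eq_minus_tail[of a s "Suc i", OF pos] by (simp add: d_def add.commute)
  have P: "P i = ?z i * P (Suc i)" for i
  proof (cases i)
    case 0
    then show ?thesis by (simp add: P_def A_seq_def d_def)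
  next
    case (Suc j)
    then show ?thesis
      unfolding Suc up up_Suc using z[of "Suc j"] by (simp del: minus_tail.simps)
  qed
  then show "P i = ?z i * P (Suc i)" .
  have "0 < A_up s a i" for i
  proof (induction i)
    case (Suc i)
    then show ?case
      using z[of "Suc i"] unfolding up_Suc by (simp del: minus_tail.simps)
  qed simp
  then show "P (Suc i) > 0" by (simp add: up)
  have "of_int (minus_quotient a i) = ?z i + 1 / ?z (Suc i)"
    using minus_tail_rec[of a i, OF pos] by (simp only: d_def)
  moreover have "P (Suc (Suc i)) = P (Suc i) / ?z (Suc i)"
    using P[of "Suc i"] z[of "Suc i"] by (simp only: nonzero_mult_div_cancel_left)
  ultimately show "P (Suc (Suc i)) = of_int (minus_quotient a i) * P (Suc i) - P i"
    unfolding P[of i] by (simp add: algebra_simps)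
qed

lemma xy_pair_eq:
  assumes pos: "\<And>i. 0 < a i" and "q > 0" and d: "d = plus_cf a + 1" and L: "L = lattice2 1 d"
  shows "xy_pair q s a L d C D (int (Suc i))
    = (nu_shift q a C D (Suc (Suc i)), 1 - nu_shift q a C D (Suc i))"
proof -
  define P where "P i = A_seq s a d (int i - 1)" for i
  define V where "V = nu_shift q a C D"
  define w where "w = (of_int C + of_int D * d) / of_nat q"
  have P_step: "P (Suc (Suc i)) = of_int (minus_quotient a i) * P (Suc i) - P i" for i
    using A_seq_step(3)[of a s i, OF pos] by (simp only: P_def d)
  have L_eq: "lattice2 (P i) (P (Suc i)) = L" for i
  proof (induction i)
    case 0
    then show ?case by (simp add: P_def A_seq_def L lattice2_commute)
  next
    case (Suc i)
    then show ?case unfolding P_step[of i] by (simp only: lattice2_step)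
  qed
  \<comment> \<open>\<open>P\<close> satisfies the three-term recursion exactly and \<open>V\<close>
    satisfies it modulo 1, so this determinant-like expression is invariant modulo \<open>L\<close>.
    The initial values of \<open>V\<close> are chosen to make it congruent to
    \<open>w\<close>.\<close>
  have memb: "V (Suc i) * P i - V i * P (Suc i) - w \<in> L" for i
  proof (induction i)
    case 0
    obtain m where m: "of_int D / of_nat q - frac1 (of_int D / real q) = of_int m"
      by (rule Ints_cases[OF frac1_diff_Ints])
    have "V (Suc 0) * P 0 - V 0 * P (Suc 0) - w
        = frac1 (of_int D / real q) * d - (of_nat q - of_int C) / of_nat q - w"
      by (simp add: V_def P_def A_seq_def)
    also have "\<dots> = of_int (- 1) * 1 + of_int (- m) * d"
      using \<open>q > 0\<close> by (simp add: w_def m[symmetric] field_simps)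
    also have "\<dots> \<in> L"
      unfolding L lattice2_def by blast
    finally show ?case .
  next
    case (Suc i)
    obtain m where m: "of_int (minus_quotient a i) * V (Suc i) - V i - V (Suc (Suc i)) = of_int m"
      using frac1_diff_Ints[of "of_int (minus_quotient a i) * V (Suc i) - V i"]
      by (auto simp: V_def elim: Ints_cases)
    have V: "V (Suc (Suc i)) = of_int (minus_quotient a i) * V (Suc i) - V i - of_int m"
      using m by simp
    have "V (Suc (Suc i)) * P (Suc i) - V (Suc i) * P (Suc (Suc i)) - w
        = (V (Suc i) * P i - V i * P (Suc i) - w) - (of_int 0 * P i + of_int m * P (Suc i))"
      unfolding V P_step by (simp add: algebra_simps)
    also have "\<dots> \<in> L"
    proof (rule lattice2_diff[of _ "P i" "P (Suc i)", unfolded L_eq])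
      show "of_int 0 * P i + of_int m * P (Suc i) \<in> L"
        unfolding L_eq[of i, symmetric] lattice2_def by blast
    qed (rule Suc.IH)
    finally show ?case .
  qed
  \<comment> \<open>\<open>V 0\<close> is \<open>(q - C) / q\<close> and may lie outside (0, 1].
    From index 1 on the terms are fractional parts, so \<open>V j\<close> and
    \<open>V (Suc j)\<close> are both bounded.\<close>
  define j where "j = Suc i"
  have Pj: "A_seq s a d (int j - 1) = P j" "A_seq s a d (int j) = P (Suc j)"
    by (simp_all add: P_def)
  have coset: "t \<in> {w + z | z. z \<in> L} \<longleftrightarrow> t - w \<in> L" for t
    by (auto simp: algebra_simps) (metis add.commute diff_add_cancel)
  have nz: "P (Suc j) \<noteq> 0" and irr: "P j / P (Suc j) \<notin> \<rat>"
    using A_seq_step(1,2)[of a s j, OF pos] minus_tail_irrational[of a j, OF pos]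
    by (auto simp add: P_def d)
  \<comment> \<open>Adding the lattice vector \<open>P (Suc j)\<close> moves the second coefficient
    from \<open>- V j\<close>, in [-1, 0), to \<open>1 - V j\<close>, in [0, 1).\<close>
  have "of_int 0 * P j + of_int 1 * P (Suc j) \<in> L"
    unfolding L_eq[of j, symmetric] lattice2_def by blast
  then have "V (Suc j) * P j - V j * P (Suc j) - w + P (Suc j) \<in> L"
    using lattice2_add[of _ "P j" "P (Suc j)", unfolded L_eq, OF memb[of j]] by simp
  then have sol: "V (Suc j) * P j + (1 - V j) * P (Suc j) - w \<in> L"
    by (simp add: algebra_simps)
  have bounds: "0 < V (Suc j)" "V (Suc j) \<le> 1" "0 < V j" "V j \<le> 1"
    unfolding V_def j_def by (rule nu_shift_bounds)+
  have rats: "V i \<in> \<rat>" for i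
    unfolding V_def using \<open>q > 0\<close> by (rule nu_shift_Rats)
  have uniq: "x = V (Suc j) \<and> y = 1 - V j"
    if "x \<in> \<rat>" "y \<in> \<rat>" "0 < x" "x \<le> 1" "0 \<le> y" "y < 1"
      "x * P j + y * P (Suc j) - w \<in> L" for x y
  proof -
    have "(x * P j + y * P (Suc j) - w) - (V (Suc j) * P j + (1 - V j) * P (Suc j) - w)
        \<in> lattice2 (P j) (P (Suc j))"
      using lattice2_diff[of _ "P j" "P (Suc j)", unfolded L_eq, OF that(7) sol] L_eq by simp
    also have "(x * P j + y * P (Suc j) - w) - (V (Suc j) * P j + (1 - V j) * P (Suc j) - w)
        = (x - V (Suc j)) * P j + (y - (1 - V j)) * P (Suc j)"
      by (simp add: algebra_simps)
    finally have "x - V (Suc j) \<in> \<int>" "y - (1 - V j) \<in> \<int>"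
      using lattice2_coordinates[OF nz irr, of "x - V (Suc j)" "y - (1 - V j)"] that rats
      by auto
    then obtain m n where mn: "x - V (Suc j) = of_int m" "y - (1 - V j) = of_int n"
      by (auto elim!: Ints_cases)
    have "\<bar>real_of_int m\<bar> < 1" "\<bar>real_of_int n\<bar> < 1"
      using that bounds unfolding mn[symmetric] by auto
    then have "m = 0" "n = 0" by linarith+
    with mn show ?thesis by simp
  qed
  show ?thesis
    unfolding xy_pair_def w_def[symmetric] Pj coset V_def[symmetric] j_def[symmetric]
    by (rule the_equality) (use sol bounds rats uniq in auto)
qed

section \<open>The sequence of residues\<close>

lemma residue1_props:
  assumes "q > 0"
  shows "1 \<le> residue1 q t" "residue1 q t \<le> int q" "int q dvd t - residue1 q t"
proof -
  have "\<exists>!u. 1 \<le> u \<and> u \<le> int q \<and> [u = t] (mod (int q))"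
  proof
    \<comment> \<open>Shifting by one before and after the reduction turns the residues 0, ..., q -
      1 into 1, ..., q.\<close>
    show "1 \<le> (t - 1) mod int q + 1 \<and> (t - 1) mod int q + 1 \<le> int q
        \<and> [(t - 1) mod int q + 1 = t] (mod (int q))"
      using assms by (simp add: cong_def mod_simps add1_zle_eq)
    fix u
    assume u: "1 \<le> u \<and> u \<le> int q \<and> [u = t] (mod (int q))"
    then have "[u - 1 = t - 1] (mod (int q))"
      by (intro cong_diff) auto
    then show "u = (t - 1) mod int q + 1"
      using u by (simp add: cong_def)
  qed
  then have "1 \<le> residue1 q t \<and> residue1 q t \<le> int q \<and> [residue1 q t = t] (mod (int q))"
    unfolding residue1_def by (rule theI')
  then show "1 \<le> residue1 q t" "residue1 q t \<le> int q" "int q dvd t - residue1 q t"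
    by (auto simp: cong_iff_dvd_diff dvd_diff_commute)
qed

section \<open>Runs of the sequence \<nu> and reduction of the quotients modulo q\<close>

lemma nu_rec:
  "nu q g C D (int i + 1)
    = frac1 (of_int (minus_quotient g i) * nu q g C D (int i) - nu q g C D (int i - 1))"
  by (simp add: nu_def nat_add_distrib)

lemma nu_bounds: "0 \<le> i \<Longrightarrow> 0 < nu q g C D i" "0 \<le> i \<Longrightarrow> nu q g C D i \<le> 1"
  by (simp_all add: nu_def nat_add_distrib nu_shift_bounds)

lemma nu_Ints: "q > 0 \<Longrightarrow> of_nat q * nu q g C D i \<in> \<int>"
  by (simp add: nu_def nu_shift_Ints)

lemma d_CD_Ints:
  assumes "q > 0"
  shows "of_nat q * d_CD q g C D l \<in> \<int>"
  unfolding d_CD_def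
  by (rule frac1_mult_Ints) (simp add: right_diff_distrib assms nu_Ints)

text \<open>A quotient 2 preserves the first difference modulo 1. The quotient at an index acts on
  the next term only, so the progression reaches up to and including the start of the next run. The
  two initial terms hold by the definition of \<open>d_CD\<close>.\<close>

lemma nu_progression:
  assumes pos: "\<And>i. 0 < g i" and "int t \<le> g (2 * l + 1)"
  shows "nu q g C D (odd_sum g l + int t)
    = frac1 (nu q g C D (odd_sum g l) + real t * d_CD q g C D l)"
  using assms(2)
proof (induction t rule: induct_nat_012)
  case 0
  show ?case
    using nu_bounds[of "odd_sum g l" q g C D] odd_sum_nonneg[of g l, OF pos]
    by (simp add: frac1_eqI)
next
  case 1
  have "nu q g C D (odd_sum g l) + d_CD q g C D l - nu q g C D (odd_sum g l + 1) \<in> \<int>"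
    using Ints_minus[OF frac1_diff_Ints[of
        "nu q g C D (odd_sum g l + 1) - nu q g C D (odd_sum g l)"]]
    by (simp add: d_CD_def algebra_simps)
  then show ?case
    using nu_bounds[of "odd_sum g l + 1" q g C D] odd_sum_nonneg[of g l, OF pos]
    by (simp add: frac1_eqI)
next
  case (ge2 t)
  let ?x = "\<lambda>t. nu q g C D (odd_sum g l) + real t * d_CD q g C D l"
  define i where "i = nat (odd_sum g l + int (Suc t))"
  have i: "int i = odd_sum g l + int (Suc t)"
    using odd_sum_nonneg[of g l, OF pos] by (simp add: i_def)
  have "minus_quotient g i = 2"
    using ge2.prems i by (intro minus_quotient_inside[of g l, OF pos]) auto
  then have "nu q g C D (odd_sum g l + int (Suc (Suc t)))
      = frac1 (2 * frac1 (?x (Suc t)) - frac1 (?x t))"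
    using nu_rec[of q g C D i] ge2 by (simp add: i algebra_simps)
  also have "\<dots> = frac1 (?x (Suc (Suc t)))"
  proof (rule frac1_cong)
    have "2 * frac1 (?x (Suc t)) - frac1 (?x t) - ?x (Suc (Suc t))
        = (?x t - frac1 (?x t)) - 2 * (?x (Suc t) - frac1 (?x (Suc t)))"
      by (simp add: algebra_simps)
    also have "\<dots> \<in> \<int>"
      by (intro Ints_diff[OF frac1_diff_Ints] Ints_mult[OF _ frac1_diff_Ints]) simp
    finally show "2 * frac1 (?x (Suc t)) - frac1 (?x t) - ?x (Suc (Suc t)) \<in> \<int>" .
  qed
  finally show ?case .
qed

lemma nu_run_end:
  assumes pos: "\<And>i. 0 < g i"
  shows "nu q g C D (odd_sum g (Suc l))
      = frac1 (nu q g C D (odd_sum g l) + of_int (g (2 * l + 1)) * d_CD q g C D l)"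
    and "nu q g C D (odd_sum g (Suc l) - 1)
      = frac1 (nu q g C D (odd_sum g l) + (of_int (g (2 * l + 1)) - 1) * d_CD q g C D l)"
proof -
  define p where "p = nat (g (2 * l + 1)) - 1"
  have p: "g (2 * l + 1) = int (Suc p)"
    using pos[of "2 * l + 1"] by (simp add: p_def)
  show "nu q g C D (odd_sum g (Suc l))
      = frac1 (nu q g C D (odd_sum g l) + of_int (g (2 * l + 1)) * d_CD q g C D l)"
    using nu_progression[of g "Suc p" l q C D, OF pos] p by simp
  show "nu q g C D (odd_sum g (Suc l) - 1)
      = frac1 (nu q g C D (odd_sum g l) + (of_int (g (2 * l + 1)) - 1) * d_CD q g C D l)"
    using nu_progression[of g p l q C D, OF pos] p by simp
qed

lemma nu_run_next:
  assumes pos: "\<And>i. 0 < g i"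
  shows "nu q g C D (odd_sum g l + 1) = frac1 (of_int (g (2 * l) + 2) * nu q g C D (odd_sum g l)
    - nu q g C D (odd_sum g l - 1))"
proof -
  have "int (nat (odd_sum g l)) = odd_sum g l"
    using odd_sum_nonneg[of g l, OF pos] by simp
  then show ?thesis
    using nu_rec[of q g C D "nat (odd_sum g l)"]
      minus_quotient_odd_sum[of g "nat (odd_sum g l)" l, OF pos] by simp
qed

lemma frac1_add_multiple:
  assumes "of_nat q * d \<in> \<int>"
  shows "frac1 (x + (y + of_nat q * of_int T) * d) = frac1 (x + y * d)"
proof (rule frac1_cong)
  have "x + (y + of_nat q * of_int T) * d - (x + y * d) = of_int T * (of_nat q * d)"
    by (simp add: algebra_simps)
  then show "x + (y + of_nat q * of_int T) * d - (x + y * d) \<in> \<int>"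
    using assms by simp
qed

text \<open>
  Within a run of quotients 2 the sequence \<open>\<nu>\<close> is an arithmetic progression modulo 1, of period
  \<open>q\<close>, and the quotients at the ends of the runs only matter modulo \<open>q\<close>.
\<close>

lemma nu_reduction:
  assumes "q > 0" and a: "\<And>i. 0 < a i" and g: "\<And>i. 0 < g i"
    and eq: "\<And>i. a i = g i + int q * T i"
  shows "nu q a C D (odd_sum a l) = nu q g C D (odd_sum g l)"
    and "nu q a C D (odd_sum a l + 1) = nu q g C D (odd_sum g l + 1)"
    and "nu q a C D (odd_sum a (Suc l) - 1) = nu q g C D (odd_sum g (Suc l) - 1)"
    and "d_CD q a C D l = d_CD q g C D l"
proof -
  have next_eq: "nu q a C D (odd_sum a l + 1) = nu q g C D (odd_sum g l + 1)"
    if at: "nu q a C D (odd_sum a l) = nu q g C D (odd_sum g l)"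
      "nu q a C D (odd_sum a l - 1) = nu q g C D (odd_sum g l - 1)" for l
  proof -
    have "of_int (a (2 * l) + 2) = real_of_int (g (2 * l) + 2) + of_nat q * of_int (T (2 * l))"
      by (simp add: eq)
    then show ?thesis
      unfolding nu_run_next[of a, OF a] nu_run_next[of g, OF g] at
      using frac1_add_multiple[OF nu_Ints[OF \<open>q > 0\<close>, of g C D "odd_sum g l"],
          of "- nu q g C D (odd_sum g l - 1)" "real_of_int (g (2 * l) + 2)" "T (2 * l)"]
      by (simp add: algebra_simps)
  qed
  have run: "nu q a C D (odd_sum a (Suc l)) = nu q g C D (odd_sum g (Suc l))
      \<and> nu q a C D (odd_sum a (Suc l) - 1) = nu q g C D (odd_sum g (Suc l) - 1)"
    if at: "nu q a C D (odd_sum a l) = nu q g C D (odd_sum g l)"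
      "nu q a C D (odd_sum a l + 1) = nu q g C D (odd_sum g l + 1)" for l
  proof -
    have d: "d_CD q a C D l = d_CD q g C D l"
      by (simp add: d_CD_def at)
    have 1: "of_int (a (2 * l + 1))
        = real_of_int (g (2 * l + 1)) + of_nat q * of_int (T (2 * l + 1))"
      by (simp add: eq)
    have 2: "of_int (a (2 * l + 1)) - 1
        = real_of_int (g (2 * l + 1)) - 1 + of_nat q * of_int (T (2 * l + 1))"
      by (simp add: eq)
    show ?thesis
      unfolding nu_run_end[of a, OF a] nu_run_end[of g, OF g] at(1) d 2
      unfolding 1
      by (simp only: frac1_add_multiple[OF d_CD_Ints[OF \<open>q > 0\<close>]])
  qed
  \<comment> \<open>Two consecutive terms determine the rest: \<open>run\<close> carries agreement
    to the last two terms of a run, and \<open>next_eq\<close> carries it across the quotient at the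
    junction. The initial values are common to both sequences.\<close>
  have main: "nu q a C D (odd_sum a l) = nu q g C D (odd_sum g l)
      \<and> nu q a C D (odd_sum a l + 1) = nu q g C D (odd_sum g l + 1)" for l
  proof (induction l)
    case 0
    have "nu q a C D (odd_sum a 0) = nu q g C D (odd_sum g 0)"
      "nu q a C D (odd_sum a 0 - 1) = nu q g C D (odd_sum g 0 - 1)"
      by (simp_all add: nu_def)
    with next_eq[of 0] show ?case by blast
  next
    case (Suc l)
    then show ?case
      using run[of l] next_eq[of "Suc l"] by blast
  qed
  then show "nu q a C D (odd_sum a l) = nu q g C D (odd_sum g l)"
    "nu q a C D (odd_sum a l + 1) = nu q g C D (odd_sum g l + 1)"
    "nu q a C D (odd_sum a (Suc l) - 1) = nu q g C D (odd_sum g (Suc l) - 1)"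
    "d_CD q a C D l = d_CD q g C D l"
    using run[of l] by (simp_all add: d_CD_def)
qed

text \<open>This is \<open>sum_progression\<close> of length \<open>p = (g - 1) + q * u\<close>,
  where \<open>u\<close> counts full periods. As \<open>q * d\<close> is an integer, these periods
  leave the end values unchanged and shift \<open>int1\<close> by \<open>u * q * d\<close>, so the
  result is affine in \<open>u\<close>.\<close>

lemma run_contribution:
  fixes C D :: int and l :: nat
  assumes "q > 0" and a: "\<And>i. 0 < a i" and g: "\<And>i. 0 < g i"
    and eq: "\<And>i. a i = g i + int q * T i"
  defines "d \<equiv> d_CD q g C D l" and "x0 \<equiv> nu q g C D (odd_sum g l)"
    and "N \<equiv> \<lambda>t. nu q a C D (odd_sum a l + int t)"
  shows "(\<Sum>t=1..nat (a (2 * l + 1)) - 1. 12 * B2 (N t) - 12 * B1 (N t) * B1 (N (t - 1)))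
    = 6 * ((of_int (g (2 * l + 1)) - 1) * d\<^sup>2
            + (1 - 2 * d) * int1 (x0 + d * (of_int (g (2 * l + 1)) - 1))
            + B2 (nu q g C D (odd_sum g (l + 1) - 1)) - B2 x0)
      - of_int (g (2 * l + 1)) + 1
      + of_int (T (2 * l + 1)) *
          (6 * (of_nat q * d\<^sup>2 + (1 - 2 * d) * int1 (x0 + d * of_nat q)) - of_nat q)"
proof -
  define p where "p = nat (a (2 * l + 1)) - 1"
  define c where "c = real_of_int (g (2 * l + 1)) - 1"
  define u where "u = T (2 * l + 1)"
  have p: "a (2 * l + 1) = int p + 1"
    using a[of "2 * l + 1"] by (simp add: p_def)
  then have "real p = of_int (a (2 * l + 1)) - 1" by simp
  then have rp: "real p = c + of_nat q * of_int u"
    by (simp add: c_def u_def eq)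
  have d_bounds: "0 \<le> d" "d \<le> 1"
    using frac1_bounds by (auto simp: d_def d_CD_def intro: less_imp_le)
  have x0_bounds: "0 < x0" "x0 \<le> 1"
    using nu_bounds[of "odd_sum g l" q g C D] odd_sum_nonneg[of g l, OF g] by (simp_all add: x0_def)
  obtain m where m: "of_nat q * d = of_int m"
    using d_CD_Ints[OF \<open>q > 0\<close>, of g C D l] unfolding d_def by (elim Ints_cases)
  have N: "N t = frac1 (x0 + real t * d)" if "t \<le> p" for t
    using nu_progression[of a t l q C D, OF a] that p nu_reduction[of q a g T C D l, OF \<open>q > 0\<close> a g eq]
    by (simp add: N_def x0_def d_def)
  have "(\<Sum>t=1..p. 12 * B2 (N t) - 12 * B1 (N t) * B1 (N (t - 1)))
      = (\<Sum>t=1..p. 12 * B2 (frac1 (x0 + real t * d))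
          - 12 * B1 (frac1 (x0 + real t * d)) * B1 (frac1 (x0 + real (t - 1) * d)))"
    by (intro sum.cong) (auto simp: N)
  also have "\<dots> = 6 * (real p * d\<^sup>2 + (1 - 2 * d) * int1 (x0 + real p * d)
      + B2 (frac1 (x0 + real p * d)) - B2 x0) - real p"
    by (rule sum_progression[OF x0_bounds d_bounds])
  also have "frac1 (x0 + real p * d) = nu q g C D (odd_sum g (l + 1) - 1)"
    using frac1_add_multiple[OF d_CD_Ints[OF \<open>q > 0\<close>, of g C D l], of x0 c u]
      nu_run_end(2)[of g q C D l, OF g]
    by (simp add: rp c_def x0_def d_def)
  also have "x0 + real p * d = (x0 + d * c) + of_int (u * m)"
    by (simp add: rp m[symmetric] algebra_simps)
  also have "int1 ((x0 + d * c) + of_int (u * m)) = int1 (x0 + d * c) + of_int u * (of_nat q * d)"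
    unfolding m int1_add_of_int by simp
  finally have sum: "(\<Sum>t=1..p. 12 * B2 (N t) - 12 * B1 (N t) * B1 (N (t - 1)))
      = 6 * ((c + of_nat q * of_int u) * d\<^sup>2
            + (1 - 2 * d) * (int1 (x0 + d * c) + of_int u * (of_nat q * d))
            + B2 (nu q g C D (odd_sum g (l + 1) - 1)) - B2 x0) - (c + of_nat q * of_int u)"
    unfolding rp .
  \<comment> \<open>Since \<open>x0\<close> lies in (0, 1] and \<open>q * d\<close> is an integer,
    the bracket multiplied by \<open>T\<close> in the claim reduces to \<open>q * d\<close>.\<close>
  have "int1 (x0 + d * of_nat q) = of_nat q * d"
    using int1_add_of_int[of x0 m] int1_eq_0[OF x0_bounds] by (simp add: m[symmetric] mult.commute)
  then show ?thesis
    unfolding p_def[symmetric] u_def[symmetric] sum by (simp add: c_def algebra_simps)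
qed

section \<open>Assembling the sum over one period\<close>

lemma quotient_at_mod: "quotient_at s \<alpha> \<beta> n (i mod s) = quotient_at s \<alpha> \<beta> n i"
  by (simp add: quotient_at_def cyc_def)

theorem proposition3p8:
  fixes q s :: nat
    and N :: "nat set"
    and K \<bb> :: "nat \<Rightarrow> real set"
    and \<delta> :: "nat \<Rightarrow> real"
    and \<alpha> \<beta> :: "nat \<Rightarrow> int"
    and C D :: int
  assumes "q > 0" and "s > 0"
    and "N = UNIV \<or> N = {1..}"
    and "\<And>n. n \<in> N \<Longrightarrow> real_quadratic_field (K n)"
    and "\<And>n. n \<in> N \<Longrightarrow> integral_ideal (K n) (\<bb> n)"
    and "\<And>n. n \<in> N \<Longrightarrow> ideal_coprime_to (K n) (\<bb> n) q"
    and "\<And>n. n \<in> N \<Longrightarrow> ideal_inverse (K n) (\<bb> n) = lattice2 1 (\<delta> n)"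
    and "\<And>n i. n \<in> N \<Longrightarrow> i < s \<Longrightarrow> quotient_at s \<alpha> \<beta> n i > 0"
    and "\<And>n. n \<in> N \<Longrightarrow> \<delta> n - 1 = plus_cf (quotient_at s \<alpha> \<beta> n)"
  shows "\<forall>n\<in>N. \<forall>k r. n = q * k + r \<and> r \<le> q - 1 \<longrightarrow>
    (let a = quotient_at s \<alpha> \<beta> n;
         L = ideal_inverse (K n) (\<bb> n);
         x = x_coord q s a L (\<delta> n) C D;
         y = y_coord q s a L (\<delta> n) C D
     in (\<Sum>i = 1..period_m s a. B1 (x i) * B1 (y i) + of_int (b_seq s a i) / 2 * B2 (x i))
          = 1 / 12 * (A_CD q s \<alpha> \<beta> C D r + real k * B_CD q s \<alpha> \<beta> C D r))"
proof (intro ballI allI impI)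
  fix n k r
  assume n: "n \<in> N" and nkr: "n = q * k + r \<and> r \<le> q - 1"
  define a where "a = quotient_at s \<alpha> \<beta> n"
  define g where "g = gamma_at q s \<alpha> \<beta> r"
  define \<tau> where "\<tau> = tau_at q s \<alpha> \<beta> r"
  define L where "L = ideal_inverse (K n) (\<bb> n)"
  define x where "x = x_coord q s a L (\<delta> n) C D"
  define y where "y = y_coord q s a L (\<delta> n) C D"
  \<comment> \<open>From \<open>n = q * k + r\<close>, the quotient at \<open>n\<close> is the one
    at \<open>r\<close> plus \<open>q * k\<close> times the coefficient \<alpha>. \<open>T\<close>
    collects all multiples of \<open>q\<close>; being affine in \<open>k\<close>, it separates
    \<open>A_CD\<close> from \<open>B_CD\<close>.\<close>
  define T where "T i = \<tau> i + int k * cyc s \<alpha> i" for i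
  define J where "J = s_mu s"
  define F where "F i = B1 (x i) * B1 (y i) + of_int (b_seq s a i) / 2 * B2 (x i)" for i
  define \<nu> where "\<nu> = nu q g C D"
  define d where "d = d_CD q g C D"
  have a: "0 < a i" for i
    using assms(8)[OF n, of "i mod s"] \<open>s > 0\<close> by (simp add: a_def quotient_at_mod)
  have g: "0 < g i" for i
    using residue1_props(1)[OF \<open>q > 0\<close>, of "quotient_at s \<alpha> \<beta> r i"]
    by (simp add: g_def gamma_at_def)
  have r_eq: "quotient_at s \<alpha> \<beta> r i = g i + int q * \<tau> i" for i
    using residue1_props(3)[OF \<open>q > 0\<close>, of "quotient_at s \<alpha> \<beta> r i"]
    by (simp add: g_def \<tau>_def gamma_at_def tau_at_def)
  have a_r: "a i = quotient_at s \<alpha> \<beta> r i + int q * int k * cyc s \<alpha> i" for i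
    using nkr by (simp add: a_def quotient_at_def algebra_simps)
  have eq: "a i = g i + int q * T i" for i
    by (simp add: a_r r_eq T_def algebra_simps)
  note reduce = nu_reduction[of q a g T C D, OF \<open>q > 0\<close> a g eq]
  have \<delta>: "\<delta> n = plus_cf a + 1"
    using assms(9)[OF n] by (simp add: a_def)
  have L: "L = lattice2 1 (\<delta> n)"
    using assms(7)[OF n] by (simp add: L_def)
  \<comment> \<open>The sign of the product comes from \<open>y i = 1 - nu q a C D (i - 1)\<close>
    and the reflection B1(1 - t) = -B1(t).\<close>
  have F: "F i = of_int (minus_quotient a (nat i)) / 2 * B2 (nu q a C D i)
      - B1 (nu q a C D i) * B1 (nu q a C D (i - 1))" if "1 \<le> i" for i
  proof -
    define j where "j = nat (i - 1)"
    then have i: "i = int (Suc j)"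
      using that by simp
    have xy: "x i = nu q a C D i" "y i = 1 - nu q a C D (i - 1)"
      using xy_pair_eq[of a q, OF a \<open>q > 0\<close> \<delta> L, of s C D j]
      by (simp_all add: x_def y_def x_coord_def y_coord_def nu_def i nat_add_distrib)
    have "b_seq s a i = minus_quotient a (nat i)"
      using that by (simp add: b_seq_def)
    then show ?thesis
      unfolding F_def xy by (simp add: B1_def algebra_simps)
  qed
  \<comment> \<open>Summands of \<open>A_CD\<close> and, with a prime, of \<open>B_CD\<close>:
    \<open>X\<close> and \<open>X'\<close> belong to the ends of runs, reindexed from 0,
    \<open>R\<close> and \<open>R'\<close> to their interiors.\<close>
  define Z where "Z l = 6 * (of_nat q * (d l)\<^sup>2
      + (1 - 2 * d l) * int1 (\<nu> (odd_sum g l) + d l * of_nat q)) - of_nat q" for l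
  define X where "X l = - 12 * B1 (\<nu> (odd_sum g (Suc l))) * B1 (\<nu> (odd_sum g (Suc l) - 1))
      + 6 * (of_int (quotient_at s \<alpha> \<beta> r (2 * Suc l)) + 2) * B2 (\<nu> (odd_sum g (Suc l)))" for l
  define X' where
    "X' l = 6 * of_nat q * of_int (cyc s \<alpha> (2 * Suc l)) * B2 (\<nu> (odd_sum g (Suc l)))" for l
  define R where "R l = 6 * ((of_int (g (2 * l + 1)) - 1) * (d l)\<^sup>2
        + (1 - 2 * d l) * int1 (\<nu> (odd_sum g l) + d l * (of_int (g (2 * l + 1)) - 1))
        + B2 (\<nu> (odd_sum g (l + 1) - 1)) - B2 (\<nu> (odd_sum g l)))
      - of_int (g (2 * l + 1)) + 1 + of_int (\<tau> (2 * l + 1)) * Z l" for l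
  define R' where "R' l = of_int (cyc s \<alpha> (2 * l + 1)) * Z l" for l
  have F_end: "12 * F (odd_sum a (Suc l)) = X l + real k * X' l" for l
  proof -
    have "1 \<le> odd_sum a (Suc l)"
      using odd_sum_nonneg[of a l, OF a] a[of "2 * l + 1"] by simp
    moreover from this have "minus_quotient a (nat (odd_sum a (Suc l))) = a (2 * Suc l) + 2"
      by (intro minus_quotient_odd_sum[of a, OF a]) simp
    ultimately have "F (odd_sum a (Suc l))
        = (of_int (a (2 * Suc l)) + 2) / 2 * B2 (\<nu> (odd_sum g (Suc l)))
          - B1 (\<nu> (odd_sum g (Suc l))) * B1 (\<nu> (odd_sum g (Suc l) - 1))"
      using reduce(1)[of "Suc l"] reduce(3)[of l] by (simp only: F \<nu>_def of_int_add of_int_numeral)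
    then show ?thesis
      unfolding a_r X_def X'_def by (simp add: field_simps)
  qed
  \<comment> \<open>With the quotient 2 the summand of \<open>F\<close> becomes B2 - B1 B1, which is
    the form that \<open>run_contribution\<close> evaluates.\<close>
  have "(\<Sum>t=1..nat (a (2 * l + 1)) - 1. 12 * F (odd_sum a l + int t))
      = (\<Sum>t=1..nat (a (2 * l + 1)) - 1. 12 * B2 (nu q a C D (odd_sum a l + int t))
          - 12 * B1 (nu q a C D (odd_sum a l + int t))
            * B1 (nu q a C D (odd_sum a l + int (t - 1))))" for l
  proof (rule sum.cong)
    fix t
    assume t: "t \<in> {1..nat (a (2 * l + 1)) - 1}"
    have pos: "1 \<le> odd_sum a l + int t"
      using t odd_sum_nonneg[of a l, OF a] by simp
    have two: "minus_quotient a (nat (odd_sum a l + int t)) = 2"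
      using t pos by (intro minus_quotient_inside[of a l, OF a]) auto
    have prev: "odd_sum a l + int t - 1 = odd_sum a l + int (t - 1)"
      using t by simp
    show "12 * F (odd_sum a l + int t) = 12 * B2 (nu q a C D (odd_sum a l + int t))
        - 12 * B1 (nu q a C D (odd_sum a l + int t)) * B1 (nu q a C D (odd_sum a l + int (t - 1)))"
      unfolding F[OF pos] two prev by simp
  qed simp
  then have F_run: "(\<Sum>t=1..nat (a (2 * l + 1)) - 1. 12 * F (odd_sum a l + int t))
      = R l + real k * R' l" for l
    unfolding run_contribution[of q a g T, OF \<open>q > 0\<close> a g eq]
    by (simp add: R_def R'_def Z_def \<nu>_def d_def T_def algebra_simps)
  have shift: "(\<Sum>l = 1..J. f l) = (\<Sum>l = 0..<J. f (Suc l))" for f :: "nat \<Rightarrow> real"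
    by (simp add: sum.atLeast1_atMost_eq atLeast0LessThan)
  have "12 * (\<Sum>i=1..period_m s a. F i)
      = (\<Sum>l=0..<J. (\<Sum>t=1..nat (a (2 * l + 1)) - 1. 12 * F (odd_sum a l + int t))
          + 12 * F (odd_sum a (Suc l)))"
    unfolding period_m_def J_def[symmetric] sum_over_runs[of a, OF a]
    by (simp only: sum_distrib_left distrib_left sum.distrib)
  also have "\<dots> = (\<Sum>l=0..<J. (R l + real k * R' l) + (X l + real k * X' l))"
    unfolding F_run F_end ..
  also have "\<dots> = ((\<Sum>l=0..<J. X l) + (\<Sum>l=0..<J. R l))
      + real k * ((\<Sum>l=0..<J. X' l) + (\<Sum>l=0..<J. R' l))"
    by (simp add: sum.distrib sum_distrib_left distrib_left)
  also have "(\<Sum>l=0..<J. X l) + (\<Sum>l=0..<J. R l) = A_CD q s \<alpha> \<beta> C D r"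
    unfolding A_CD_def Let_def X_def R_def Z_def \<nu>_def d_def g_def \<tau>_def J_def[symmetric] shift ..
  also have "(\<Sum>l=0..<J. X' l) + (\<Sum>l=0..<J. R' l) = B_CD q s \<alpha> \<beta> C D r"
    unfolding B_CD_def Let_def X'_def R'_def Z_def \<nu>_def d_def g_def J_def[symmetric] shift ..
  finally have "(\<Sum>i=1..period_m s a. F i)
      = 1 / 12 * (A_CD q s \<alpha> \<beta> C D r + real k * B_CD q s \<alpha> \<beta> C D r)"
    by simp
  then show "let a = quotient_at s \<alpha> \<beta> n;
         L = ideal_inverse (K n) (\<bb> n);
         x = x_coord q s a L (\<delta> n) C D;
         y = y_coord q s a L (\<delta> n) C D
     in (\<Sum>i = 1..period_m s a. B1 (x i) * B1 (y i) + of_int (b_seq s a i) / 2 * B2 (x i))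
          = 1 / 12 * (A_CD q s \<alpha> \<beta> C D r + real k * B_CD q s \<alpha> \<beta> C D r)"
    unfolding Let_def F_def x_def y_def L_def a_def .
qed

end
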